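(* For every positive integer $n$, the integral closure (in the quotient field $\mathbb{Q}(X)$) of the ring $\mathrm{Int}(M_n(\mathbb{Z}))=\{f\in\mathbb{Q}[X]\mid f(M)\in M_n(\mathbb{Z})\ \text{for all } M\in M_n(\mathbb{Z})\}$ is equal to the ring $\mathrm{Int}_{\mathbb{Q}}(A_n,\mathcal{A}_n)=\{f\in\mathbb{Q}[X]\mid f(A_n)\subset\mathcal{A}_n\}$ of polynomials with rational coefficients which are integral-valued over the set of algebraic integers of degree equal to $n$.
   Context: $M_n(\mathbb{Z})$ is the ring of $n\times n$ integer matrices. $\mathcal{A}_n$ is the set of all algebraic integers of degree less than or equal to $n$ over $\mathbb{Q}$ in a fixed algebraic closure of $\mathbb{Q}$, and $A_n\subseteq\mathcal{A}_n$ is the subset of those of degree exactly $n$. *)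

theory Defs
  imports
    "HOL-Algebra.Algebraic_Closure_Type"
    "Jordan_Normal_Form.Matrix"
begin

text \<open>
  Several names are qualified because HOL-Algebra and the library of polynomials over type
  classes both define \<open>degree\<close>, \<open>coeff\<close>, \<open>lead_coeff\<close>, \<open>irreducible\<close> and \<open>algebraic\<close>.
\<close>

text \<open>\<open>R\<close> is meant to be the carrier of a subring of the ambient commutative ring.\<close>

definition integral_over :: "'a :: comm_ring_1 set \<Rightarrow> 'a \<Rightarrow> bool" where
  "integral_over R x \<longleftrightarrow>
     (\<exists>p :: 'a poly. Polynomial.lead_coeff p = 1 \<and> (\<forall>i. Polynomial.coeff p i \<in> R) \<and> poly p x = 0)"

definition integral_closure :: "'a :: comm_ring_1 set \<Rightarrow> 'a set" where
  "integral_closure R = {x. integral_over R x}"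

definition poly_mat :: "nat \<Rightarrow> 'a :: comm_semiring_1 poly \<Rightarrow> 'a mat \<Rightarrow> 'a mat" where
  "poly_mat n f M =
     finsum (ring_mat TYPE('a) n ()) (\<lambda>k. Polynomial.coeff f k \<cdot>\<^sub>m (M ^\<^sub>m k)) {..Polynomial.degree f}"

definition int_matrices :: "nat \<Rightarrow> rat mat set" where
  "int_matrices n = map_mat of_int ` (carrier_mat n n :: int mat set)"

definition Int_mat :: "nat \<Rightarrow> rat poly set" where
  "Int_mat n = {f. \<forall>M \<in> int_matrices n. poly_mat n f M \<in> int_matrices n}"

definition eval_ac :: "rat poly \<Rightarrow> rat alg_closure \<Rightarrow> rat alg_closure" where
  "eval_ac f x = poly (map_poly to_ac f) x"

definition min_rat_poly :: "rat alg_closure \<Rightarrow> rat poly" where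
  "min_rat_poly x =
     (THE p. Factorial_Ring.irreducible p \<and> Polynomial.lead_coeff p = 1 \<and> eval_ac p x = 0)"

definition alg_degree :: "rat alg_closure \<Rightarrow> nat" where
  "alg_degree x = Polynomial.degree (min_rat_poly x)"

definition alg_ints_le :: "nat \<Rightarrow> rat alg_closure set" where
  "alg_ints_le n = {x. algebraic_int x \<and> alg_degree x \<le> n}"

definition alg_ints_eq :: "nat \<Rightarrow> rat alg_closure set" where
  "alg_ints_eq n = {x. algebraic_int x \<and> alg_degree x = n}"

definition Int_Q :: "rat alg_closure set \<Rightarrow> rat alg_closure set \<Rightarrow> rat poly set" where
  "Int_Q A B = {f. \<forall>x \<in> A. eval_ac f x \<in> B}"

text \<open>The definite description in \<open>min_rat_poly\<close> is always justified.\<close>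

lemma eval_ac_add: "eval_ac (p + q) x = eval_ac p x + eval_ac q x"
proof -
  have "map_poly to_ac (p + q) = map_poly to_ac p + map_poly to_ac q"
    by (intro poly_eqI) (simp add: coeff_map_poly)
  thus ?thesis by (simp add: eval_ac_def)
qed

lemma eval_ac_mult: "eval_ac (p * q) x = eval_ac p x * eval_ac q x"
proof -
  have "map_poly to_ac (p * q) = map_poly to_ac p * map_poly to_ac q"
    by (intro poly_eqI) (simp add: coeff_map_poly coeff_mult to_ac_sum)
  thus ?thesis by (simp add: eval_ac_def)
qed

lemma eval_ac_1: "eval_ac 1 x = 1"
  by (simp add: eval_ac_def)

lemma ex1_min_rat_poly:
  "\<exists>!p. Factorial_Ring.irreducible p \<and> Polynomial.lead_coeff p = 1 \<and> eval_ac p x = 0"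
proof -
  obtain p where "p \<noteq> 0 \<and> eval_ac p x = 0"
    using alg_closure_algebraic[of x] unfolding eval_ac_def by metis
  then obtain p where p: "p \<noteq> 0" "eval_ac p x = 0"
    and min: "\<And>q. q \<noteq> 0 \<Longrightarrow> eval_ac q x = 0 \<Longrightarrow> Polynomial.degree p \<le> Polynomial.degree q"
    using ex_has_least_nat[of "\<lambda>p. p \<noteq> 0 \<and> eval_ac p x = 0" p Polynomial.degree] by blast
  define m where "m = Polynomial.smult (inverse (Polynomial.lead_coeff p)) p"
  have m0: "m \<noteq> 0" and dm: "Polynomial.degree m = Polynomial.degree p"
    and lm: "Polynomial.lead_coeff m = 1"
    using p by (auto simp: m_def)
  have "m = [:inverse (Polynomial.lead_coeff p):] * p" by (simp add: m_def)
  hence em: "eval_ac m x = 0" using p(2) by (simp only: eval_ac_mult) simp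
  have nu: "\<not> is_unit m"
  proof
    assume "is_unit m"
    then obtain q where "m * q = 1" by (metis dvdE)
    thus False using eval_ac_mult[of m q x] em by (simp add: eval_ac_1)
  qed
  have div: "m dvd q" if "eval_ac q x = 0" for q
  proof -
    have "eval_ac q x = eval_ac (q div m) x * eval_ac m x + eval_ac (q mod m) x"
      by (metis eval_ac_add eval_ac_mult div_mult_mod_eq)
    hence "eval_ac (q mod m) x = 0" using em that by simp
    hence "q mod m = 0"
      using min[of "q mod m"] degree_mod_less[OF m0, of q] dm by fastforce
    thus ?thesis by blast
  qed
  have irr: "Factorial_Ring.irreducible m"
  proof (rule Factorial_Ring.irreducibleI)
    fix a b assume ab: "m = a * b"
    hence "eval_ac a x = 0 \<or> eval_ac b x = 0" using em by (simp add: eval_ac_mult)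
    hence "m dvd a \<or> m dvd b" using div by blast
    thus "is_unit a \<or> is_unit b" using ab m0
      by (metis dvd_times_left_cancel_iff dvd_times_right_cancel_iff mult.right_neutral
          mult.left_neutral mult_eq_0_iff)
  qed (use m0 nu in auto)
  show ?thesis
  proof (rule ex1I[of _ m])
    fix q assume q: "Factorial_Ring.irreducible q \<and> Polynomial.lead_coeff q = 1 \<and> eval_ac q x = 0"
    then obtain c where c: "q = m * c" using div by blast
    hence "is_unit c" using q nu by (metis Factorial_Ring.irreducibleD)
    then obtain k where k: "c = [:k:]" by (auto elim: is_unit_polyE)
    have "k = 1" using q lm by (auto simp: c k split: if_splits)
    thus "q = m" by (simp add: c k)
  qed (use irr lm em in auto)
qed

end

(*  Let P be the set of monic polynomials of degree n over Z. If f mod chi has integer coefficients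
    for every chi in P, then f lies in Int(M_n(Z)), because char_poly M is in P and annihilates M.
    Conversely, if f is in Int(M_n(Z)) and x has minimal polynomial chi in P, then evaluating f at
    the companion matrix of chi shows that f(x) is in Z[x]. Hence a rational function integral over
    Int(M_n(Z)) is a polynomial whose value at x is integral over Z[x], of degree at most deg x.

    For the other inclusion let f(A_n) consist of integers of degree at most n, let d be a common
    denominator of f and put D = d^n. Choose phi monic over Z divisible modulo D by every monic
    integer polynomial of degree at most n (there are finitely many modulo D). If chi in P is
    irreducible with root x, and m is the minimal polynomial of f(x), then phi = m q + D u, and u may
    be reduced modulo m, so phi(f(x)) = D r(f(x)) with deg r < n, where D r(f(X)) has integer
    coefficients. So phi(f) mod chi has integer coefficients. Every chi in P is congruent to an
    irreducible (Eisenstein) one modulo any given N, so this holds for all chi in P. Therefore phi(f)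
    lies in Int(M_n(Z)), and f is a root of phi(Y) - phi(f).  *)

theory Submission
  imports Defs "Jordan_Normal_Form.Char_Poly"
begin

hide_const (open) UnivPoly.coeff Polynomials.degree Module.smult Divisibility.irreducible

section \<open>Polynomials in a matrix\<close>

lemma finsum_ring_mat:
  fixes g :: "'b \<Rightarrow> 'a :: comm_ring_1 mat"
  assumes "finite A" "\<And>k. k \<in> A \<Longrightarrow> g k \<in> carrier_mat n n"
  shows "finsum (ring_mat TYPE('a) n ()) g A = mat n n (\<lambda>ij. \<Sum>k\<in>A. g k $$ ij)"
  using assms
proof (induction A rule: finite_induct)
  case empty
  interpret ring "ring_mat TYPE('a) n ()" by (rule ring_mat)
  show ?case using finsum_empty[of g] by (auto simp: ring_mat_def)
next
  case (insert x A)
  interpret ring "ring_mat TYPE('a) n ()" by (rule ring_mat)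
  have "finsum (ring_mat TYPE('a) n ()) g (insert x A) = g x + finsum (ring_mat TYPE('a) n ()) g A"
    using insert finsum_insert[of A x g] by (auto simp: ring_mat_def)
  also have "\<dots> = mat n n (\<lambda>ij. \<Sum>k\<in>insert x A. g k $$ ij)"
    using insert by (intro eq_matI) auto
  finally show ?case .
qed

text \<open>Entry \<open>(i, j)\<close> of f(M) as a functional linear in \<open>f\<close>; the
  arguments about matrices below thus become identities between finite sums of scalars.\<close>

definition mat_entry :: "'a :: comm_ring_1 mat \<Rightarrow> nat \<Rightarrow> nat \<Rightarrow> 'a poly \<Rightarrow> 'a" where
  "mat_entry M i j f = (\<Sum>k\<le>degree f. coeff f k * (M ^\<^sub>m k) $$ (i, j))"

lemma poly_mat_eq:
  fixes M :: "'a :: comm_ring_1 mat"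
  assumes "M \<in> carrier_mat n n"
  shows "poly_mat n f M = mat n n (\<lambda>(i, j). mat_entry M i j f)"
  unfolding poly_mat_def using assms
  by (subst finsum_ring_mat) (auto simp: mat_entry_def intro!: eq_matI sum.cong)

lemma mat_entry_upto:
  assumes "degree f \<le> N"
  shows "mat_entry M i j f = (\<Sum>k\<le>N. coeff f k * (M ^\<^sub>m k) $$ (i, j))"
  unfolding mat_entry_def
  by (rule sum.mono_neutral_left) (use assms in \<open>auto simp: coeff_eq_0\<close>)

lemma mat_entry_add: "mat_entry M i j (f + g) = mat_entry M i j f + mat_entry M i j g"
proof -
  define N where "N = max (degree f) (degree g)"
  have "degree f \<le> N" "degree g \<le> N" "degree (f + g) \<le> N"
    by (auto simp: N_def degree_add_le_max)
  thus ?thesis by (simp add: mat_entry_upto[of _ N] sum.distrib algebra_simps)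
qed

lemma mat_entry_smult: "mat_entry M i j (smult c f) = c * mat_entry M i j f"
  by (subst mat_entry_upto[of _ "degree f"])
     (simp_all add: mat_entry_def sum_distrib_left mult_ac degree_smult_le)

lemma mat_entry_0 [simp]: "mat_entry M i j 0 = 0"
  by (simp add: mat_entry_def)

lemma mat_entry_sum: "mat_entry M i j (sum f A) = (\<Sum>a\<in>A. mat_entry M i j (f a))"
  by (induction A rule: infinite_finite_induct) (auto simp: mat_entry_add)

text \<open>As \<open>M ^\<^sub>m Suc k\<close> is \<open>M ^\<^sub>m k * M\<close>, a factor X of
  the polynomial multiplies each row of its value by \<open>M\<close> on the right.\<close>

lemma mat_entry_shift:
  fixes M :: "'a :: comm_ring_1 mat"
  assumes M: "M \<in> carrier_mat n n" "i < n" "j < n"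
  shows "mat_entry M i j (pCons 0 f) = (\<Sum>l<n. mat_entry M i l f * M $$ (l, j))"
proof -
  have *: "(M ^\<^sub>m Suc k) $$ (i, j) = (\<Sum>l<n. (M ^\<^sub>m k) $$ (i, l) * M $$ (l, j))" for k
    using M pow_carrier_mat[OF M(1), of k]
    by (auto simp: scalar_prod_def lessThan_atLeast0 intro!: sum.cong)
  have "mat_entry M i j (pCons 0 f) = (\<Sum>k\<le>degree f. coeff f k * (M ^\<^sub>m Suc k) $$ (i, j))"
    by (subst mat_entry_upto[of _ "Suc (degree f)"])
       (simp_all add: degree_pCons_le sum.atMost_Suc_shift del: sum.atMost_Suc pow_mat.simps)
  also have "\<dots> = (\<Sum>l<n. mat_entry M i l f * M $$ (l, j))"
    unfolding * mat_entry_def sum_distrib_left sum_distrib_right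
    by (subst sum.swap) (simp add: mult.assoc)
  finally show ?thesis .
qed

text \<open>
  In row \<open>i\<close>, the functionals \<open>g \<mapsto> mat_entry M i l g\<close> are annihilated by the matrix \<open>X I - M\<close>, hence by
  its product with its adjugate, which is \<open>char_poly M\<close> times the identity.
\<close>

lemma cayley_hamilton_entry:
  fixes M :: "'a :: comm_ring_1 mat"
  assumes M: "M \<in> carrier_mat n n" "i < n" "k < n"
  shows "mat_entry M i k (char_poly M * g) = 0"
proof -
  define N where "N = char_poly_matrix M"
  have N: "N \<in> carrier_mat n n" using M by (simp add: N_def)
  have Nlj: "N $$ (l, j) * h = (if l = j then pCons 0 h else 0) + smult (- (M $$ (l, j))) h"
    if "l < n" "j < n" for l j h
    using that M by (auto simp: N_def char_poly_matrix_def)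
  have kill: "(\<Sum>l<n. mat_entry M i l (N $$ (l, j) * h)) = 0" if j: "j < n" for j h
  proof -
    have "(\<Sum>l<n. mat_entry M i l (N $$ (l, j) * h)) =
       (\<Sum>l<n. (if l = j then mat_entry M i j (pCons 0 h) else 0) - mat_entry M i l h * M $$ (l, j))"
      using j by (intro sum.cong refl) (auto simp: Nlj mat_entry_add mat_entry_smult simp del: smult_minus_left mult_pCons_left)
    also have "\<dots> = 0"
      using j by (simp add: sum_subtractf mat_entry_shift[OF M(1,2) j])
    finally show ?thesis .
  qed
  define A where "A = adj_mat N"
  have A: "A \<in> carrier_mat n n" "N * A = det N \<cdot>\<^sub>m 1\<^sub>m n"
    using adj_mat[OF N] by (auto simp: A_def)
  have NA: "(\<Sum>j<n. N $$ (l, j) * A $$ (j, k)) = (if l = k then char_poly M else 0)" if l: "l < n" for l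
  proof -
    have "(\<Sum>j<n. N $$ (l, j) * A $$ (j, k)) = (N * A) $$ (l, k)"
      using l M A(1) N by (auto simp: scalar_prod_def lessThan_atLeast0 intro!: sum.cong)
    also have "\<dots> = (if l = k then char_poly M else 0)"
      unfolding A(2) char_poly_def N_def[symmetric] using l M by auto
    finally show ?thesis .
  qed
  have "0 = (\<Sum>j<n. \<Sum>l<n. mat_entry M i l (N $$ (l, j) * (A $$ (j, k) * g)))"
    using kill by simp
  also have "\<dots> = (\<Sum>l<n. mat_entry M i l (\<Sum>j<n. N $$ (l, j) * (A $$ (j, k) * g)))"
    by (subst sum.swap) (simp add: mat_entry_sum)
  also have "\<dots> = (\<Sum>l<n. mat_entry M i l ((\<Sum>j<n. N $$ (l, j) * A $$ (j, k)) * g))"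
    by (simp add: sum_distrib_right mult.assoc)
  also have "\<dots> = (\<Sum>l<n. if l = k then mat_entry M i k (char_poly M * g) else 0)"
    by (intro sum.cong refl) (auto simp: NA)
  also have "\<dots> = mat_entry M i k (char_poly M * g)"
    using M by simp
  finally show ?thesis by simp
qed

lemma mat_entry_of_int:
  assumes M: "M \<in> carrier_mat n n" "i < n" "j < n"
  shows "mat_entry (map_mat of_int M) i j (of_int_poly f) = (of_int (mat_entry M i j f) :: 'a :: {comm_ring_1, ring_char_0})"
proof -
  have "map_mat of_int M ^\<^sub>m k = (map_mat of_int (M ^\<^sub>m k) :: 'a mat)" for k
    by (rule of_int_hom.mat_hom_pow[OF M(1), symmetric])
  thus ?thesis
    using M pow_carrier_mat[OF M(1)] by (simp add: mat_entry_def)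
qed

text \<open>By Cayley-Hamilton, \<open>f\<close> and its remainder modulo the characteristic
  polynomial have the same value at an integer matrix, and an integral remainder has an integral
  value there.\<close>

lemma mod_int_poly_imp_Int_mat:
  assumes "\<And>\<chi> :: int poly. degree \<chi> = n \<Longrightarrow> lead_coeff \<chi> = 1 \<Longrightarrow> f mod of_int_poly \<chi> \<in> range of_int_poly"
  shows "f \<in> Int_mat n"
  unfolding Int_mat_def
proof safe
  fix M assume "M \<in> int_matrices n"
  then obtain M0 :: "int mat" where M0: "M0 \<in> carrier_mat n n" and M: "M = map_mat of_int M0"
    by (auto simp: int_matrices_def)
  define c where "c = (of_int_poly (char_poly M0) :: rat poly)"
  have c: "c = char_poly M"
    unfolding c_def M by (rule of_int_hom.char_poly_hom[OF M0, symmetric])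
  have "degree (char_poly M0) = n" "lead_coeff (char_poly M0) = 1"
    using degree_monic_char_poly[OF M0] by auto
  then obtain r where r: "f mod c = of_int_poly r"
    using assms unfolding c_def by blast
  have Mc: "M \<in> carrier_mat n n" using M0 M by simp
  have "mat_entry M i j f = of_int (mat_entry M0 i j r)" if "i < n" "j < n" for i j
  proof -
    have "mat_entry M i j f = mat_entry M i j (c * (f div c) + f mod c)" by simp
    also have "\<dots> = mat_entry M i j (f mod c)"
      unfolding mat_entry_add c using cayley_hamilton_entry[OF Mc that] by simp
    also have "\<dots> = of_int (mat_entry M0 i j r)"
      unfolding r M using mat_entry_of_int[OF M0 that] .
    finally show ?thesis .
  qed
  hence "poly_mat n f M = map_mat of_int (mat n n (\<lambda>(i, j). mat_entry M0 i j r))"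
    unfolding poly_mat_eq[OF Mc] by (intro eq_matI) auto
  thus "poly_mat n f M \<in> int_matrices n"
    by (auto simp: int_matrices_def)
qed

section \<open>Companion matrices and eigenvectors\<close>

text \<open>With the coefficients in the last row, rather than the last column, the powers 1, a,
  ..., a^(n-1) of a root a form a column eigenvector for a.\<close>

definition companion :: "'a :: comm_ring_1 poly \<Rightarrow> 'a mat" where
  "companion p = mat (degree p) (degree p)
     (\<lambda>(i, j). if Suc i < degree p then (if j = Suc i then 1 else 0) else - coeff p j)"

lemma companion_carrier [simp]: "companion p \<in> carrier_mat (degree p) (degree p)"
  by (simp add: companion_def)

lemma companion_of_int: "companion (of_int_poly p :: 'a :: {comm_ring_1,ring_char_0} poly) = map_mat of_int (companion p)"
  by (intro eq_matI) (auto simp: companion_def)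

lemma comm_ring_hom_to_ac: "comm_ring_hom to_ac"
  by standard auto

lemma eval_ac_altdef: "eval_ac f x = (\<Sum>k\<le>degree f. to_ac (coeff f k) * x ^ k)"
  by (simp add: eval_ac_def poly_altdef degree_map_poly coeff_map_poly)

text \<open>Every row but the last picks out the next power of \<open>a\<close>; the last row is the
  equation p(a) = 0 solved for the leading power.\<close>

lemma companion_eigen:
  assumes "lead_coeff p = 1" "eval_ac p a = 0" "i < degree p"
  shows "(\<Sum>j<degree p. to_ac (companion p $$ (i, j)) * a ^ j) = a * a ^ i"
proof (cases "Suc i < degree p")
  case True
  have "(\<Sum>j<degree p. to_ac (companion p $$ (i, j)) * a ^ j) = (\<Sum>j<degree p. if j = Suc i then a ^ j else 0)"
    using True by (intro sum.cong refl) (auto simp: companion_def)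
  thus ?thesis using True by simp
next
  case False
  hence i: "Suc i = degree p" using assms by simp
  have "(\<Sum>j<degree p. to_ac (companion p $$ (i, j)) * a ^ j) = - (\<Sum>j<degree p. to_ac (coeff p j) * a ^ j)"
    using False assms(3) by (simp add: companion_def sum_negf)
  also have "\<dots> = a ^ degree p"
    using assms(1,2) unfolding eval_ac_altdef lessThan_Suc_atMost[symmetric]
    by (simp add: neg_eq_iff_add_eq_0)
  finally show ?thesis by (simp flip: i)
qed

text \<open>An eigenvector of \<open>C\<close> for \<open>a\<close> is one of f(C) for f(a): this
  holds for powers by induction, then for linear combinations. \<open>C\<close> is rational, whereas
  \<open>v\<close> and \<open>a\<close> live in the algebraic closure.\<close>

lemma mat_entry_eigen:
  fixes C :: "rat mat"
  assumes C: "C \<in> carrier_mat n n"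
    and eig: "\<And>i. i < n \<Longrightarrow> (\<Sum>j<n. to_ac (C $$ (i, j)) * v j) = a * v i"
    and i: "i < n"
  shows "(\<Sum>j<n. to_ac (mat_entry C i j f) * v j) = eval_ac f a * v i"
proof -
  have pow: "(\<Sum>j<n. to_ac ((C ^\<^sub>m k) $$ (i, j)) * v j) = a ^ k * v i" for k
  proof (induction k)
    case 0
    have "(\<Sum>j<n. to_ac ((C ^\<^sub>m 0) $$ (i, j)) * v j) = (\<Sum>j<n. if j = i then v i else 0)"
      using C i by (intro sum.cong refl) auto
    thus ?case using i by simp
  next
    case (Suc k)
    have *: "(C ^\<^sub>m Suc k) $$ (i, j) = (\<Sum>l<n. (C ^\<^sub>m k) $$ (i, l) * C $$ (l, j))" if "j < n" for j
      using C i that pow_carrier_mat[OF C, of k]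
      by (auto simp: scalar_prod_def lessThan_atLeast0 intro!: sum.cong)
    have "(\<Sum>j<n. to_ac ((C ^\<^sub>m Suc k) $$ (i, j)) * v j) =
          (\<Sum>j<n. \<Sum>l<n. to_ac ((C ^\<^sub>m k) $$ (i, l)) * (to_ac (C $$ (l, j)) * v j))"
      by (intro sum.cong refl) (simp add: * to_ac_sum sum_distrib_right mult.assoc del: pow_mat.simps)
    also have "\<dots> = (\<Sum>l<n. to_ac ((C ^\<^sub>m k) $$ (i, l)) * (a * v l))"
      by (subst sum.swap) (simp add: eig flip: sum_distrib_left)
    also have "\<dots> = a * (\<Sum>l<n. to_ac ((C ^\<^sub>m k) $$ (i, l)) * v l)"
      by (simp add: sum_distrib_left mult_ac)
    finally show ?case unfolding Suc.IH by (simp add: mult_ac)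
  qed
  have "(\<Sum>j<n. to_ac (mat_entry C i j f) * v j) =
    (\<Sum>k\<le>degree f. to_ac (coeff f k) * (\<Sum>j<n. to_ac ((C ^\<^sub>m k) $$ (i, j)) * v j))"
    unfolding mat_entry_def to_ac_sum sum_distrib_left sum_distrib_right
    by (subst sum.swap) (simp add: mult.assoc)
  thus ?thesis by (simp add: pow eval_ac_altdef sum_distrib_right mult.assoc)
qed

text \<open>Serves with \<open>h = of_int\<close>, where the monic integer polynomial proves
  integrality, and with \<open>h = to_ac\<close>, where its degree bounds that of
  \<open>y\<close>.\<close>

lemma char_poly_root_of_eigen:
  fixes h :: "'a :: comm_ring_1 \<Rightarrow> 'b :: field"
  assumes "comm_ring_hom h"
  assumes B: "B \<in> carrier_mat n n"
    and eig: "\<And>i. i < n \<Longrightarrow> (\<Sum>j<n. h (B $$ (i, j)) * v j) = y * v i"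
    and k: "k < n" "v k \<noteq> 0"
  shows "poly (map_poly h (char_poly B)) y = 0"
proof -
  interpret h: comm_ring_hom h by fact
  have B': "map_mat h B \<in> carrier_mat n n" using B by simp
  have "eigenvector (map_mat h B) (vec n v) y"
    unfolding eigenvector_def
  proof (intro conjI)
    show "vec n v \<noteq> 0\<^sub>v (dim_row (map_mat h B))"
      using k B by (metis B' carrier_matD(1) index_vec index_zero_vec(1))
    show "map_mat h B *\<^sub>v vec n v = y \<cdot>\<^sub>v vec n v"
      using B by (intro eq_vecI) (auto simp: scalar_prod_def eig[symmetric] lessThan_atLeast0 intro!: sum.cong)
  qed (use B in auto)
  hence "poly (char_poly (map_mat h B)) y = 0"
    using eigenvalue_root_char_poly[OF B'] by (auto simp: eigenvalue_def)
  thus ?thesis by (simp add: h.char_poly_hom[OF B])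
qed

section \<open>Integrality\<close>

text \<open>For finite \<open>V\<close> this is the additive group generated by \<open>V\<close>; a
  sum over an infinite set is 0 by convention.\<close>

definition int_span :: "'a :: comm_ring_1 set \<Rightarrow> 'a set" where
  "int_span V = range (\<lambda>c. \<Sum>z\<in>V. of_int (c z) * z)"

lemma int_span_add: "x \<in> int_span V \<Longrightarrow> y \<in> int_span V \<Longrightarrow> x + y \<in> int_span V"
proof -
  assume "x \<in> int_span V" "y \<in> int_span V"
  then obtain c d where "x = (\<Sum>z\<in>V. of_int (c z) * z)" "y = (\<Sum>z\<in>V. of_int (d z) * z)"
    by (auto simp: int_span_def)
  hence "x + y = (\<Sum>z\<in>V. of_int (c z + d z) * z)"
    by (simp add: sum.distrib distrib_right)
  thus ?thesis unfolding int_span_def by (intro image_eqI[where x = "\<lambda>z. c z + d z"]) auto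
qed

lemma int_span_mult: "x \<in> int_span V \<Longrightarrow> of_int k * x \<in> int_span V"
proof -
  assume "x \<in> int_span V"
  then obtain c where "x = (\<Sum>z\<in>V. of_int (c z) * z)" by (auto simp: int_span_def)
  hence "of_int k * x = (\<Sum>z\<in>V. of_int (k * c z) * z)"
    by (simp add: sum_distrib_left mult_ac)
  thus ?thesis unfolding int_span_def by (intro image_eqI[where x = "\<lambda>z. k * c z"]) auto
qed

lemma int_span_0: "0 \<in> int_span V"
  unfolding int_span_def by (intro image_eqI[where x = "\<lambda>_. 0"]) auto

lemma int_span_uminus: "x \<in> int_span V \<Longrightarrow> - x \<in> int_span V"
  using int_span_mult[of x V "-1"] by simp

lemma int_span_sum: "(\<And>i. i \<in> A \<Longrightarrow> f i \<in> int_span V) \<Longrightarrow> sum f A \<in> int_span V"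
  by (induction A rule: infinite_finite_induct) (auto intro: int_span_add int_span_0)

lemma int_span_base: "finite V \<Longrightarrow> x \<in> V \<Longrightarrow> x \<in> int_span V"
  unfolding int_span_def 
  by (intro image_eqI[where x = "\<lambda>z. if z = x then 1 else 0"]) (auto simp: if_distrib if_distribR cong: if_cong)

text \<open>The determinant trick: multiplication by \<open>y\<close> on the generators is an
  integer matrix \<open>B\<close>, and the tuple of generators, nonzero because of \<open>w\<close>,
  is an eigenvector of \<open>B\<close> for \<open>y\<close>. So \<open>y\<close> is a root of
  \<open>char_poly B\<close>.\<close>

lemma algebraic_int_if_int_span_stable:
  fixes y :: "'a :: field"
  assumes "finite V" "w \<in> V" "w \<noteq> 0" and stable: "\<And>x. x \<in> V \<Longrightarrow> y * x \<in> int_span V"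
  shows "algebraic_int y"
proof -
  obtain v where v: "bij_betw v {..<card V} V"
    using ex_bij_betw_nat_finite[OF \<open>finite V\<close>] by (auto simp: lessThan_atLeast0)
  have "\<forall>x. \<exists>c. x \<in> V \<longrightarrow> y * x = (\<Sum>z\<in>V. of_int (c z) * z)"
    using stable by (auto simp: int_span_def)
  then obtain c where c: "\<And>x. x \<in> V \<Longrightarrow> y * x = (\<Sum>z\<in>V. of_int (c x z) * z)" by metis
  define B where "B = mat (card V) (card V) (\<lambda>(i, j). c (v i) (v j))"
  have B: "B \<in> carrier_mat (card V) (card V)" by (simp add: B_def)
  obtain k where k: "k < card V" "v k \<noteq> 0"
    using assms(2,3) v by (metis bij_betw_iff_bijections lessThan_iff)
  have "(\<Sum>j<card V. of_int (B $$ (i, j)) * v j) = y * v i" if "i < card V" for i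
  proof -
    have "v i \<in> V" using that v by (auto dest: bij_betwE)
    hence "y * v i = (\<Sum>z\<in>V. of_int (c (v i) z) * z)" by (rule c)
    also have "\<dots> = (\<Sum>j<card V. of_int (c (v i) (v j)) * v j)"
      by (rule sum.reindex_bij_betw[OF v, symmetric])
    finally show ?thesis using that by (simp add: B_def)
  qed
  hence root: "poly (of_int_poly (char_poly B)) y = 0"
    by (intro char_poly_root_of_eigen[where h = of_int and v = v and n = "card V" and k = k])
       (use B k in \<open>auto intro: of_int_hom.comm_ring_hom_axioms\<close>)
  have "degree (char_poly B) = card V" "coeff (char_poly B) (card V) = 1"
    using degree_monic_char_poly[OF B] by auto
  hence "lead_coeff (of_int_poly (char_poly B) :: 'a poly) = 1"
    by (subst degree_map_poly) auto
  with root show ?thesis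
    by (intro algebraic_int.intros[of "of_int_poly (char_poly B)"]) auto
qed

text \<open>Transitivity of integrality: \<open>y\<close> is integral over Z[a] and \<open>a\<close>
  over Z, so finitely many monomials \<open>a ^ j * y ^ i\<close> span a group stable under
  multiplication by \<open>y\<close>.\<close>

lemma algebraic_int_over_int_adjoin:
  fixes a y :: "'a :: field"
  assumes \<chi>: "lead_coeff \<chi> = 1" "poly (of_int_poly \<chi>) a = 0"
    and y: "y ^ m = (\<Sum>i<m. poly (of_int_poly (s i)) a * y ^ i)"
  shows "algebraic_int y"
proof -
  define n where "n = degree \<chi>"
  define V where "V = (\<lambda>(j, i). a ^ j * y ^ i) ` ({..<n} \<times> {..<m})"
  have fin: "finite V" by (simp add: V_def)
  have deg: "degree (of_int_poly \<chi> :: 'a poly) = n"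
    unfolding n_def using \<chi> by (intro degree_map_poly) auto
  \<comment> \<open>Degree 0 would make \<open>\<chi>\<close> the constant 1, which has no root, and
    \<open>m = 0\<close> would read 1 = 0. Both being positive puts 1 into \<open>V\<close>.\<close>
  have "n > 0"
    using \<chi> by (auto simp: n_def intro!: Nat.gr0I elim!: degree_eq_zeroE)
  have "m > 0"
    using y by (auto intro!: Nat.gr0I)
  have an: "a ^ n = - (\<Sum>j<n. of_int (coeff \<chi> j) * a ^ j)"
  proof -
    have "(\<Sum>j\<le>n. of_int (coeff \<chi> j) * a ^ j) = 0"
      using \<chi>(2) by (simp add: poly_altdef deg)
    thus ?thesis using \<chi>(1) by (simp add: n_def eq_neg_iff_add_eq_0 add.commute flip: lessThan_Suc_atMost)
  qed
  \<comment> \<open>The exponent \<open>k\<close> is arbitrary here: the equation of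
    \<open>a\<close> lowers it until it is below \<open>n\<close>.\<close>
  have mono: "a ^ k * y ^ i \<in> int_span V" if "i < m" for i k
  proof (induction k rule: less_induct)
    case (less k)
    show ?case
    proof (cases "k < n")
      case True
      thus ?thesis using that by (intro int_span_base fin) (auto simp: V_def)
    next
      case False
      have "a ^ k * y ^ i = a ^ n * (a ^ (k - n) * y ^ i)"
        using False by (simp flip: power_add mult.assoc)
      also have "\<dots> = - (\<Sum>j<n. of_int (coeff \<chi> j) * (a ^ (k - n + j) * y ^ i))"
        unfolding an minus_mult_left[symmetric] sum_distrib_right power_add by (simp add: mult_ac)
      also have "\<dots> \<in> int_span V"
        using False by (intro int_span_uminus int_span_sum int_span_mult less) auto
      finally show ?thesis .
    qed
  qed
  have "y * x \<in> int_span V" if x: "x \<in> V" for x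
  proof -
    obtain j i where ji: "j < n" "i < m" "x = a ^ j * y ^ i"
      using x by (auto simp: V_def)
    have yx: "y * x = a ^ j * y ^ Suc i" by (simp add: ji)
    show ?thesis
    proof (cases "Suc i < m")
      case True
      thus ?thesis unfolding yx by (rule mono)
    next
      case False
      hence "Suc i = m" using ji by simp
      \<comment> \<open>The equation of \<open>y\<close> lowers the exponent \<open>m\<close>, at
        the price of higher powers of \<open>a\<close>, which \<open>mono\<close> absorbs.\<close>
      hence "y * x = (\<Sum>i<m. \<Sum>k\<le>degree (of_int_poly (s i) :: 'a poly). of_int (coeff (s i) k) * (a ^ (k + j) * y ^ i))"
        unfolding yx \<open>Suc i = m\<close> y poly_altdef sum_distrib_left sum_distrib_right power_add
        by (intro sum.cong refl) (auto simp: coeff_map_poly mult_ac)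
      also have "\<dots> \<in> int_span V"
        by (intro int_span_sum int_span_mult mono) auto
      finally show ?thesis .
    qed
  qed
  moreover have "1 \<in> V"
    unfolding V_def using \<open>n > 0\<close> \<open>m > 0\<close> by (intro image_eqI[where x = "(0, 0)"]) auto
  ultimately show ?thesis
    using algebraic_int_if_int_span_stable[OF fin, of 1 y] by auto
qed

section \<open>Integral elements of a fraction field\<close>

lemma to_fract_power: "to_fract (x ^ k) = to_fract x ^ k"
  by (induction k) auto

text \<open>The rational root argument: with x = a / b in lowest terms, clearing denominators in the
  monic equation shows that b divides a^n; being coprime to it, b is a unit. Over Q[X] this turns
  integral elements of Q(X) into polynomials.\<close>

lemma fract_integrally_closed:
  fixes x :: "'a :: {ring_gcd, idom_divide, semiring_gcd_mult_normalize} fract"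
  assumes p: "lead_coeff p = 1" "\<And>i. coeff p i \<in> range to_fract" "poly p x = 0"
  shows "x \<in> range to_fract"
proof -
  define a b where "a = fst (quot_of_fract x)" and "b = snd (quot_of_fract x)"
  have b: "b \<noteq> 0" and cop: "Rings.coprime a b" and x: "x = to_fract a / to_fract b"
    by (simp_all add: a_def b_def coprime_quot_of_fract flip: Fract_conv_to_fract)
  have "\<forall>i. \<exists>z. coeff p i = to_fract z" using p(2) by auto
  then obtain c where c: "\<And>i. coeff p i = to_fract (c i)" by metis
  define n where "n = degree p"
  have cn: "coeff p n = 1" using p(1) by (simp add: n_def)
  have b': "to_fract b \<noteq> 0" using b by simp
  have "0 = poly p x * to_fract b ^ n"
    using p(3) by simp
  also have "\<dots> = (\<Sum>i\<le>n. coeff p i * x ^ i * to_fract b ^ n)"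
    by (simp add: poly_altdef n_def sum_distrib_right)
  also have "\<dots> = (\<Sum>i<n. coeff p i * x ^ i * to_fract b ^ n) + x ^ n * to_fract b ^ n"
    using cn by (simp flip: lessThan_Suc_atMost)
  also have "x ^ n * to_fract b ^ n = to_fract (a ^ n)"
    using b' by (simp add: x power_divide to_fract_power)
  also have "(\<Sum>i<n. coeff p i * x ^ i * to_fract b ^ n) = to_fract (b * (\<Sum>i<n. c i * a ^ i * b ^ (n - Suc i)))"
    unfolding to_fract_sum to_fract_mult sum_distrib_left
  proof (intro sum.cong refl)
    fix i assume "i \<in> {..<n}"
    hence "to_fract b ^ n = to_fract b ^ i * (to_fract b * to_fract b ^ (n - Suc i))"
      by (simp flip: power_Suc power_add)
    hence "x ^ i * to_fract b ^ n = to_fract a ^ i * (to_fract b * to_fract b ^ (n - Suc i))"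
      using b' by (simp add: x power_divide)
    thus "coeff p i * x ^ i * to_fract b ^ n = to_fract b * (to_fract (c i) * to_fract (a ^ i) * to_fract (b ^ (n - Suc i)))"
      unfolding c to_fract_power mult.assoc by (simp only: mult_ac)
  qed
  finally have "to_fract (b * (\<Sum>i<n. c i * a ^ i * b ^ (n - Suc i)) + a ^ n) = 0" by (simp only: to_fract_add)
  hence "b * (\<Sum>i<n. c i * a ^ i * b ^ (n - Suc i)) + a ^ n = 0" by (simp only: to_fract_eq_0_iff)
  hence "a ^ n = b * (- (\<Sum>i<n. c i * a ^ i * b ^ (n - Suc i)))"
    by (simp only: mult_minus_right eq_neg_iff_add_eq_0 add.commute)
  hence "b dvd a ^ n" by (rule dvdI)
  moreover have "Rings.coprime (a ^ n) b" using cop by simp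
  ultimately have "is_unit b" using coprime_common_divisor dvd_refl by blast
  then obtain d where "1 = b * d" by (elim dvdE)
  hence "to_fract b * to_fract d = 1" by (metis to_fract_1 to_fract_mult)
  hence "to_fract d = inverse (to_fract b)" by (rule inverse_unique[symmetric])
  hence "x = to_fract (a * d)" unfolding x to_fract_mult divide_inverse by simp
  thus ?thesis by blast
qed

section \<open>Minimal polynomials\<close>

lemma eval_ac_0 [simp]: "eval_ac 0 x = 0"
  by (simp add: eval_ac_def)

lemma eval_ac_pCons: "eval_ac (pCons c p) x = to_ac c + x * eval_ac p x"
proof -
  have "map_poly to_ac (pCons c p) = pCons (to_ac c) (map_poly to_ac p)"
    by (intro poly_eqI) (simp add: coeff_map_poly coeff_pCons split: nat.split)
  thus ?thesis by (simp add: eval_ac_def)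
qed

lemma eval_ac_const [simp]: "eval_ac [:c:] x = to_ac c"
  by (simp add: eval_ac_pCons)

lemma eval_ac_smult: "eval_ac (smult c p) x = to_ac c * eval_ac p x"
  using eval_ac_mult[of "[:c:]" p x] by simp

lemma eval_ac_uminus: "eval_ac (- p) x = - eval_ac p x"
  using eval_ac_add[of p "- p" x] by (simp add: eq_neg_iff_add_eq_0 add.commute)

lemma eval_ac_diff: "eval_ac (p - q) x = eval_ac p x - eval_ac q x"
  using eval_ac_add[of p "- q" x] by (simp add: eval_ac_uminus)

lemma eval_ac_power: "eval_ac (p ^ k) x = eval_ac p x ^ k"
  by (induction k) (auto simp: eval_ac_1 eval_ac_mult)

lemma eval_ac_sum: "eval_ac (sum f A) x = (\<Sum>a\<in>A. eval_ac (f a) x)"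
  by (induction A rule: infinite_finite_induct) (auto simp: eval_ac_add)

lemma eval_ac_of_int_poly: "eval_ac (of_int_poly p) x = poly (of_int_poly p) x"
  by (simp add: eval_ac_def map_poly_map_poly comp_def)

lemma eval_ac_pcompose: "eval_ac (pcompose p q) x = eval_ac p (eval_ac q x)"
  by (induction p) (auto simp: pcompose_pCons eval_ac_add eval_ac_mult eval_ac_pCons)

lemma min_rat_poly:
  shows irreducible_min_rat_poly: "Factorial_Ring.irreducible (min_rat_poly x)"
    and lead_coeff_min_rat_poly: "lead_coeff (min_rat_poly x) = 1"
    and eval_ac_min_rat_poly: "eval_ac (min_rat_poly x) x = 0"
  using theI'[OF ex1_min_rat_poly[of x]] by (auto simp: min_rat_poly_def)

lemma min_rat_poly_eqI:
  "Factorial_Ring.irreducible p \<Longrightarrow> lead_coeff p = 1 \<Longrightarrow> eval_ac p x = 0 \<Longrightarrow> min_rat_poly x = p"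
  unfolding min_rat_poly_def by (rule the1_equality[OF ex1_min_rat_poly]) auto

text \<open>An irreducible polynomial not dividing \<open>q\<close> is coprime to it, and a Bezout
  relation evaluated at \<open>x\<close> would read 0 = 1.\<close>

lemma min_rat_poly_dvd:
  assumes "eval_ac q x = 0"
  shows "min_rat_poly x dvd q"
proof (rule ccontr)
  define p where "p = min_rat_poly x"
  assume "\<not> min_rat_poly x dvd q"
  moreover have "prime_elem p"
    using irreducible_min_rat_poly[of x] by (simp add: p_def prime_elem_iff_irreducible)
  ultimately have "Rings.coprime p q"
    using prime_elem_imp_coprime[of p q] by (simp add: p_def)
  then obtain a b where "a * p + b * q = 1"
    using bezout_coefficients_fst_snd[of p q] by (metis coprime_iff_gcd_eq_1)
  hence "eval_ac (a * p + b * q) x = 1" by (simp add: eval_ac_1)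
  thus False
    using assms eval_ac_min_rat_poly[of x] by (simp add: eval_ac_add eval_ac_mult p_def)
qed

lemma degree_min_rat_poly_pos: "degree (min_rat_poly x) > 0"
proof (rule Nat.gr0I)
  assume "degree (min_rat_poly x) = 0"
  then obtain c where c: "min_rat_poly x = [:c:]" by (auto elim: degree_eq_zeroE)
  hence "c = 1" using lead_coeff_min_rat_poly[of x] by simp
  thus False using eval_ac_min_rat_poly[of x] c by simp
qed

section \<open>Denominators and Gauss's lemma for monic factors\<close>

lemma rat_poly_common_denom:
  fixes f :: "rat poly"
  obtains d :: int and F :: "int poly" where "d > 0" "smult (of_int d) f = of_int_poly F"
proof -
  have "\<exists>d F. (d::int) > 0 \<and> smult (of_int d) f = of_int_poly F"
  proof (induction f)
    case 0
    show ?case by (intro exI[of _ 1] exI[of _ 0]) auto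
  next
    case (pCons a f)
    then obtain d F where dF: "(d::int) > 0" "smult (of_int d) f = of_int_poly F" by auto
    obtain u v where uv: "quotient_of a = (u, v)" by fastforce
    have v: "v > 0" "a = of_int u / of_int v"
      using quotient_of_denom_pos[OF uv] quotient_of_div[OF uv] by auto
    have "smult (of_int (d * v)) f = smult (of_int v) (smult (of_int d) f)"
      by (simp add: mult.commute)
    also have "\<dots> = of_int_poly (smult v F)"
      by (simp only: dF(2) of_int_hom.map_poly_hom_smult)
    finally have "smult (of_int (d * v)) (pCons a f) = of_int_poly (pCons (d * u) (smult v F))"
      using v by (simp add: of_int_hom.map_poly_pCons_hom del: of_int_mult) simp
    moreover have "d * v > 0" using dF v by simp
    ultimately show ?case by blast
  qed
  thus ?thesis using that by blast
qed

lemma monic_rat_poly_primitive: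
  fixes f :: "rat poly"
  assumes "lead_coeff f = 1"
  obtains d :: int and F :: "int poly" where "d > 0" "smult (of_int d) f = of_int_poly F" "content F = 1"
proof -
  obtain D and B :: "int poly" where D: "D > 0" "smult (of_int D) f = of_int_poly B"
    by (rule rat_poly_common_denom)
  define c where "c = content B"
  define F where "F = primitive_part B"
  have B: "B = smult c F" by (simp add: c_def F_def)
  have "lead_coeff (of_int_poly B :: rat poly) = of_int D"
    using assms by (simp flip: D(2))
  hence lB: "lead_coeff B = D" by simp
  hence "B \<noteq> 0" using D(1) by auto
  have "c \<ge> 0" by (simp add: c_def content_def)
  hence "c > 0" using \<open>B \<noteq> 0\<close> by (simp add: c_def order_less_le)
  \<comment> \<open>As \<open>f\<close> is monic, comparing leading coefficients shows which
    multiplier remains once the content is divided out.\<close>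
  have Dc: "D = c * lead_coeff F" using lB \<open>c > 0\<close> by (simp add: B)
  have "smult (of_int c) (smult (of_int (lead_coeff F)) f) = smult (of_int c) (of_int_poly F)"
    using D(2) by (simp add: Dc B of_int_hom.map_poly_hom_smult)
  hence "smult (of_int (lead_coeff F)) f = of_int_poly F"
    using \<open>c > 0\<close> by (metis of_int_eq_0_iff order_less_irrefl smult_cancel)
  moreover have "lead_coeff F > 0"
    using D(1) \<open>c > 0\<close> unfolding Dc by (simp add: zero_less_mult_iff)
  moreover have "content F = 1" using \<open>B \<noteq> 0\<close> by (simp add: F_def)
  ultimately show ?thesis using that by blast
qed

text \<open>Gauss's lemma: primitive multiples of \<open>a\<close> and \<open>b\<close> by
  \<open>d\<close> and \<open>e\<close> have a primitive product, which is
  \<open>smult (d * e) P\<close>. So \<open>d * e\<close> divides 1, and \<open>a\<close> was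
  integral already.\<close>

lemma monic_rat_factor_of_int_poly:
  fixes a b :: "rat poly"
  assumes P: "of_int_poly P = a * b" "lead_coeff P = 1" and a: "lead_coeff a = 1"
  obtains A where "a = of_int_poly A"
proof -
  have "lead_coeff (a * b) = 1" using P by (simp flip: P(1))
  hence b: "lead_coeff b = 1" using a by (simp add: lead_coeff_mult)
  obtain d A where A: "d > 0" "smult (of_int d) a = of_int_poly A" "content A = 1"
    by (rule monic_rat_poly_primitive[OF a])
  obtain e B where B: "e > 0" "smult (of_int e) b = of_int_poly B" "content B = 1"
    by (rule monic_rat_poly_primitive[OF b])
  have "of_int_poly (A * B) = smult (of_int d) a * smult (of_int e) b"
    by (simp add: A B of_int_poly_hom.hom_mult)
  also have "\<dots> = of_int_poly (smult (d * e) P)"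
    by (simp add: P(1) of_int_hom.map_poly_hom_smult mult.commute)
  finally have "A * B = smult (d * e) P" by simp
  hence "content (A * B) = content (smult (d * e) P)" by simp
  hence "\<bar>d * e\<bar> * content P = 1"
    using A(3) B(3) by (simp add: content_mult)
  hence "d * e dvd 1" by (metis abs_dvd_iff dvd_triv_left)
  hence "d = 1" using A(1) B(1) by (metis dvd_mult_left zdvd1_eq abs_of_pos)
  thus ?thesis using that A(2) by simp
qed

text \<open>The minimal polynomial is a monic factor of a monic integer polynomial, so Gauss's lemma
  applies.\<close>

lemma min_rat_poly_algebraic_int:
  assumes "algebraic_int x"
  obtains P :: "int poly" where "min_rat_poly x = of_int_poly P" "lead_coeff P = 1" "degree P = alg_degree x"
proof -
  obtain Q where Q: "poly (of_int_poly Q) x = 0" "lead_coeff Q = 1"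
    using assms by (auto simp: algebraic_int_altdef_ipoly)
  hence "min_rat_poly x dvd of_int_poly Q"
    by (intro min_rat_poly_dvd) (simp add: eval_ac_of_int_poly)
  then obtain b where "of_int_poly Q = min_rat_poly x * b" by (elim dvdE)
  then obtain P where P: "min_rat_poly x = of_int_poly P"
    using monic_rat_factor_of_int_poly Q(2) lead_coeff_min_rat_poly by metis
  have "degree P = alg_degree x" by (simp add: alg_degree_def P)
  moreover have "lead_coeff P = 1"
    using lead_coeff_min_rat_poly[of x] by (simp add: P)
  ultimately show ?thesis using that P by blast
qed

lemma alg_degree_le:
  assumes "eval_ac q x = 0" "q \<noteq> 0"
  shows "alg_degree x \<le> degree q"
  unfolding alg_degree_def using min_rat_poly_dvd[OF assms(1)] assms(2) by (rule dvd_imp_degree_le)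

section \<open>Values of polynomials at algebraic numbers\<close>

text \<open>f(x) is an eigenvalue of f(C), where C is the companion matrix of the minimal polynomial
  of \<open>x\<close>; hence it is a root of a rational characteristic polynomial of degree
  \<open>alg_degree x\<close>.\<close>

lemma alg_degree_eval_ac_le: "alg_degree (eval_ac f x) \<le> alg_degree x"
proof -
  define p n where "p = min_rat_poly x" and "n = alg_degree x"
  have n: "n = degree p" "n > 0"
    using degree_min_rat_poly_pos by (auto simp: n_def p_def alg_degree_def)
  define B where "B = mat n n (\<lambda>(i, j). mat_entry (companion p) i j f)"
  have B: "B \<in> carrier_mat n n" by (simp add: B_def)
  have "(\<Sum>j<n. to_ac (B $$ (i, j)) * x ^ j) = eval_ac f x * x ^ i" if "i < n" for i
  proof -
    have "(\<Sum>j<n. to_ac (mat_entry (companion p) i j f) * x ^ j) = eval_ac f x * x ^ i"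
      using that unfolding n
      by (intro mat_entry_eigen companion_eigen)
         (auto simp: p_def lead_coeff_min_rat_poly eval_ac_min_rat_poly)
    thus ?thesis using that by (simp add: B_def)
  qed
  hence "poly (map_poly to_ac (char_poly B)) (eval_ac f x) = 0"
    by (rule char_poly_root_of_eigen[where v = "\<lambda>j. x ^ j", OF comm_ring_hom_to_ac B _ \<open>n > 0\<close>]) auto
  hence "eval_ac (char_poly B) (eval_ac f x) = 0" by (simp add: eval_ac_def)
  moreover have "degree (char_poly B) = n" "char_poly B \<noteq> 0"
    using degree_monic_char_poly[OF B] by auto
  ultimately show ?thesis
    using alg_degree_le unfolding n_def by metis
qed

text \<open>The eigenvector of the companion matrix starts with \<open>x ^ 0 = 1\<close>, so row 0
  of the eigenvector equation for r(C) expresses r(x) in powers of \<open>x\<close>. The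
  coefficients are entries of r(C), an integer matrix.\<close>

lemma Int_mat_eval_ac:
  assumes r: "r \<in> Int_mat n" and x: "algebraic_int x" "alg_degree x = n" 
  obtains s :: "int poly" where "eval_ac r x = poly (of_int_poly s) x"
proof -
  obtain P where P: "min_rat_poly x = of_int_poly P" "lead_coeff P = 1" "degree P = n"
    using min_rat_poly_algebraic_int[OF x(1)] x(2) by metis
  define p :: "rat poly" where "p = of_int_poly P"
  have p: "p = min_rat_poly x" "degree p = n" by (simp_all add: p_def P)
  have "n > 0" using degree_min_rat_poly_pos p by metis
  have "companion p \<in> int_matrices n"
    unfolding int_matrices_def p_def companion_of_int
    using companion_carrier[of P] P(3) by blast
  hence "poly_mat n r (companion p) \<in> int_matrices n"
    using r by (auto simp: Int_mat_def)
  then obtain R :: "int mat" where R: "R \<in> carrier_mat n n" "poly_mat n r (companion p) = map_mat of_int R"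
    by (auto simp: int_matrices_def)
  have entry: "mat_entry (companion p) 0 j r = of_int (R $$ (0, j))" if "j < n" for j
  proof -
    have "mat_entry (companion p) 0 j r = poly_mat n r (companion p) $$ (0, j)"
      using \<open>n > 0\<close> that companion_carrier[of p] p by (subst poly_mat_eq) auto
    thus ?thesis using R(1) that \<open>n > 0\<close> by (simp add: R(2))
  qed
  have "eval_ac r x * x ^ 0 = (\<Sum>j<n. to_ac (mat_entry (companion p) 0 j r) * x ^ j)"
    using \<open>n > 0\<close> unfolding p(2)[symmetric]
    by (intro mat_entry_eigen[symmetric] companion_eigen)
       (auto simp: p lead_coeff_min_rat_poly eval_ac_min_rat_poly)
  also have "\<dots> = poly (of_int_poly (\<Sum>j<n. monom (R $$ (0, j)) j)) x"
    by (simp add: entry of_int_poly_hom.hom_sum poly_sum poly_monom)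
  finally show ?thesis using that by simp
qed

section \<open>First inclusion: integral elements are integral-valued polynomials\<close>

lemma integral_closure_Int_mat_subset:
  "integral_closure (to_fract ` Int_mat n) \<subseteq> to_fract ` Int_Q (alg_ints_eq n) (alg_ints_le n)"
proof
  fix u assume "u \<in> integral_closure (to_fract ` Int_mat n)"
  then obtain p where p: "lead_coeff p = 1" "\<And>i. coeff p i \<in> to_fract ` Int_mat n" "poly p u = 0"
    by (auto simp: integral_closure_def integral_over_def)
  have "u \<in> range to_fract"
    by (rule fract_integrally_closed[OF p(1) _ p(3)]) (use p(2) in blast)
  then obtain f where u: "u = to_fract f" by blast
  have "\<forall>i. \<exists>r. r \<in> Int_mat n \<and> coeff p i = to_fract r" using p(2) by blast
  then obtain r where r: "\<And>i. r i \<in> Int_mat n" "\<And>i. coeff p i = to_fract (r i)" by metis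
  define m where "m = degree p"
  have "0 = (\<Sum>i<m. coeff p i * u ^ i) + u ^ m"
    using p(1,3) by (simp add: poly_altdef m_def flip: lessThan_Suc_atMost)
  also have "\<dots> = to_fract ((\<Sum>i<m. r i * f ^ i) + f ^ m)"
    by (simp add: r(2) u to_fract_power)
  finally have "to_fract ((\<Sum>i<m. r i * f ^ i) + f ^ m) = 0" by (rule sym)
  hence "(\<Sum>i<m. r i * f ^ i) + f ^ m = 0" by (simp only: to_fract_eq_0_iff)
  hence fm: "f ^ m = (\<Sum>i<m. - r i * f ^ i)"
    by (simp add: sum_negf eq_neg_iff_add_eq_0 add.commute)
  have "eval_ac f x \<in> alg_ints_le n" if "x \<in> alg_ints_eq n" for x
  proof -
    have x: "algebraic_int x" "alg_degree x = n" using that by (auto simp: alg_ints_eq_def)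
    have "\<exists>s. eval_ac (r i) x = poly (of_int_poly s) x" for i
      using Int_mat_eval_ac[OF r(1) x] by metis
    then obtain s where s: "\<And>i. eval_ac (r i) x = poly (of_int_poly (s i)) x" by metis
    obtain P :: "int poly" where P: "min_rat_poly x = of_int_poly P" "lead_coeff P = 1"
      using min_rat_poly_algebraic_int[OF x(1)] by metis
    \<comment> \<open>The equation of \<open>f\<close> is evaluated at \<open>x\<close>: its
      coefficients then lie in Z[x], and \<open>x\<close> is integral over Z.\<close>
    have "algebraic_int (eval_ac f x)"
    proof (rule algebraic_int_over_int_adjoin)
      show "poly (of_int_poly P) x = 0"
        using eval_ac_min_rat_poly[of x] by (simp add: P eval_ac_of_int_poly)
      have "eval_ac f x ^ m = eval_ac (f ^ m) x" by (simp add: eval_ac_power)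
      also have "\<dots> = (\<Sum>i<m. poly (of_int_poly (- s i)) x * eval_ac f x ^ i)"
        unfolding fm by (simp add: eval_ac_sum eval_ac_mult eval_ac_power eval_ac_uminus s of_int_poly_hom.hom_uminus)
      finally show "eval_ac f x ^ m = (\<Sum>i<m. poly (of_int_poly (- s i)) x * eval_ac f x ^ i)" .
    qed (use P in auto)
    thus ?thesis
      using alg_degree_eval_ac_le[of f x] x by (simp add: alg_ints_le_def)
  qed
  thus "u \<in> to_fract ` Int_Q (alg_ints_eq n) (alg_ints_le n)"
    by (auto simp: u Int_Q_def)
qed

section \<open>Monic irreducible polynomials near a given one\<close>

text \<open>If \<open>B\<close> were not constant, all indices up to \<open>degree A\<close> would
  lie below \<open>degree (A * B)\<close>. Divisibility by \<open>p\<close> would then spread from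
  the constant term of \<open>A\<close> to its leading coefficient 1.\<close>

lemma eisenstein_aux:
  fixes A B :: "int poly"
  assumes p: "prime p" and div: "\<And>i. i < degree (A * B) \<Longrightarrow> p dvd coeff (A * B) i"
    and monic: "lead_coeff A = 1" "lead_coeff B = 1"
    and A0: "p dvd coeff A 0" and B0: "\<not> p dvd coeff B 0"
  shows "degree B = 0"
proof (rule ccontr)
  assume "degree B \<noteq> 0"
  moreover have "degree (A * B) = degree A + degree B"
    using monic by (intro degree_mult_eq) auto
  ultimately have deg: "degree A < degree (A * B)" by simp
  have "p dvd coeff A i" if "i \<le> degree A" for i
    using that
  proof (induction i rule: less_induct)
    case (less i)
    have "coeff (A * B) i = coeff A i * coeff B 0 + (\<Sum>j<i. coeff A j * coeff B (i - j))"
      by (simp add: coeff_mult flip: lessThan_Suc_atMost)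
    moreover have "p dvd (\<Sum>j<i. coeff A j * coeff B (i - j))"
      using less by (intro dvd_sum dvd_mult2) auto
    moreover have "p dvd coeff (A * B) i"
      using less.prems deg by (intro div) auto
    ultimately have "p dvd coeff A i * coeff B 0"
      by (simp add: dvd_add_left_iff)
    thus ?case using B0 p by (simp add: prime_dvd_mult_iff)
  qed
  from this[of "degree A"] have "p dvd 1" using monic by simp
  thus False using p by (simp add: not_prime_unit)
qed

text \<open>Rational factors are scaled to be monic, hence integral by Gauss's lemma. As
  \<open>p\<close> but not \<open>p\<^sup>2\<close> divides the constant term of \<open>P\<close>,
  exactly one factor has a constant term divisible by \<open>p\<close>, and the other factor is
  constant.\<close>

lemma eisenstein:
  fixes P :: "int poly"
  assumes p: "prime p" and monic: "lead_coeff P = 1" and deg: "degree P > 0"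
    and div: "\<And>i. i < degree P \<Longrightarrow> p dvd coeff P i" and ndiv: "\<not> p\<^sup>2 dvd coeff P 0"
  shows "Factorial_Ring.irreducible (of_int_poly P :: rat poly)"
proof (rule Factorial_Ring.irreducibleI)
  show "of_int_poly P \<noteq> (0 :: rat poly)" using deg by auto
  show "\<not> is_unit (of_int_poly P :: rat poly)"
    using deg by (auto dest!: poly_dvd_1[THEN iffD1])
  fix a b :: "rat poly" assume ab: "of_int_poly P = a * b"
  define a' b' where "a' = smult (inverse (lead_coeff a)) a" and "b' = smult (inverse (lead_coeff b)) b"
  have lead: "lead_coeff a * lead_coeff b = 1"
    using monic by (simp flip: ab lead_coeff_mult)
  hence nz: "lead_coeff a \<noteq> 0" "lead_coeff b \<noteq> 0" by auto
  have la: "lead_coeff a' = 1" "lead_coeff b' = 1" "degree a' = degree a" "degree b' = degree b"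
    using nz by (auto simp: a'_def b'_def)
  have P: "of_int_poly P = a' * b'"
    using lead by (simp add: ab a'_def b'_def mult.commute flip: inverse_mult_distrib)
  obtain A where A: "a' = of_int_poly A"
    by (rule monic_rat_factor_of_int_poly[OF P monic la(1)])
  obtain B where B: "b' = of_int_poly B"
    using monic_rat_factor_of_int_poly[of P b' a'] P monic la(2) by (metis mult.commute)
  have "of_int_poly P = (of_int_poly (A * B) :: rat poly)"
    by (simp add: P A B of_int_poly_hom.hom_mult)
  hence PAB: "P = A * B" by simp
  have monicAB: "lead_coeff A = 1" "lead_coeff B = 1"
    using la by (auto simp: A B)
  have "degree A = 0 \<or> degree B = 0"
  proof -
    have AB0: "coeff P 0 = coeff A 0 * coeff B 0" by (simp add: PAB coeff_mult)
    hence "p dvd coeff A 0 * coeff B 0" using div[of 0] deg by simp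
    hence "p dvd coeff A 0 \<or> p dvd coeff B 0" using p by (simp add: prime_dvd_mult_iff)
    moreover have "\<not> (p dvd coeff A 0 \<and> p dvd coeff B 0)"
      using ndiv by (auto simp: AB0 power2_eq_square intro: mult_dvd_mono)
    ultimately show ?thesis
      using eisenstein_aux[OF p, of A B] eisenstein_aux[OF p, of B A] div monicAB
      by (auto simp: PAB mult.commute)
  qed
  thus "is_unit a \<or> is_unit b"
    using la nz A B by (auto simp: is_unit_iff_degree)
qed

lemma int_poly_division_monic:
  fixes F \<chi> :: "int poly"
  assumes "lead_coeff \<chi> = 1" "degree \<chi> > 0"
  obtains q r where "F = \<chi> * q + r" "degree r < degree \<chi>"
proof -
  have "\<exists>q r. F = \<chi> * q + r \<and> degree r < degree \<chi>"
  proof (induction F)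
    case 0
    show ?case using assms by (intro exI[of _ 0]) auto
  next
    case (pCons a F)
    then obtain q r where qr: "F = \<chi> * q + r" "degree r < degree \<chi>" by auto
    \<comment> \<open>\<open>pCons a r\<close> has degree at most that of \<open>\<chi>\<close>, and
      \<open>c\<close> is its coefficient there; subtracting \<open>smult c \<chi>\<close> cancels
      it because \<open>\<chi>\<close> is monic.\<close>
    define c where "c = coeff (pCons a r) (degree \<chi>)"
    have "pCons a F = \<chi> * pCons c q + (pCons a r - smult c \<chi>)"
      by (simp add: qr(1) pCons_one algebra_simps)
    moreover have "degree (pCons a r - smult c \<chi>) < degree \<chi>"
    proof (rule degree_lessI)
      show "\<forall>k\<ge>degree \<chi>. coeff (pCons a r - smult c \<chi>) k = 0"
      proof safe
        fix k assume k: "k \<ge> degree \<chi>"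
        show "coeff (pCons a r - smult c \<chi>) k = 0"
        proof (cases "k = degree \<chi>")
          case True
          thus ?thesis using assms by (simp add: c_def)
        next
          case False
          hence "degree (pCons a r) < k" "degree \<chi> < k"
            using k qr(2) degree_pCons_le[of a r] by linarith+
          thus ?thesis by (simp add: coeff_eq_0)
        qed
      qed
    qed (use assms in auto)
    ultimately show ?case by blast
  qed
  thus ?thesis using that by blast
qed

text \<open>By uniqueness of division with remainder, an integer division is also the rational
  one.\<close>

lemma of_int_poly_mod_monic:
  fixes F \<chi> :: "int poly"
  assumes "degree r < degree \<chi>" "F = \<chi> * q + r"
  shows "(of_int_poly F :: rat poly) mod of_int_poly \<chi> = of_int_poly r"
  using assms(1) by (simp add: assms(2) of_int_poly_hom.hom_add of_int_poly_hom.hom_mult mod_poly_less)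

lemma of_int_poly_mod_monic_in_range:
  fixes F \<chi> :: "int poly"
  assumes "lead_coeff \<chi> = 1" "degree \<chi> > 0"
  shows "(of_int_poly F :: rat poly) mod of_int_poly \<chi> \<in> range of_int_poly"
  using int_poly_division_monic[OF assms, of F] of_int_poly_mod_monic by (metis rangeI)

text \<open>
  With \<open>p > N\<close> prime, \<open>\<chi>'\<close> is congruent to \<open>\<chi>\<close> modulo \<open>N\<close> and to \<open>X\<^sup>n + p\<close> modulo \<open>p\<^sup>2\<close>, so it is Eisenstein.
\<close>

lemma irreducible_approximation:
  fixes \<chi> :: "int poly"
  assumes \<chi>: "lead_coeff \<chi> = 1" "degree \<chi> > 0" and N: "N > 0"
  obtains \<chi>' E :: "int poly" where "\<chi>' = \<chi> + smult N E" "lead_coeff \<chi>' = 1" "degree \<chi>' = degree \<chi>"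
    "Factorial_Ring.irreducible (of_int_poly \<chi>' :: rat poly)"
proof -
  define n where "n = degree \<chi>"
  obtain p0 :: nat where p0: "prime p0" "p0 > nat N" using bigger_prime by blast
  define p where "p = int p0"
  have p: "prime p" "p > N" using p0 by (auto simp: p_def)
  have "\<not> p dvd N" using p N by (auto dest: zdvd_imp_le)
  hence "Rings.coprime N (p\<^sup>2)"
    using p(1) prime_imp_coprime[of p N] by (simp add: coprime_commute)
  then obtain u v where uv: "u * N + v * p\<^sup>2 = 1"
    using bezout_int[of N "p\<^sup>2"] by (auto simp: coprime_iff_gcd_eq_1)
  define T where "T = monom 1 n + [:p:]"
  \<comment> \<open>\<open>T\<close> is Eisenstein at \<open>p\<close>. By the Bezout relation
    \<open>N * u\<close> is 1 modulo \<open>p\<^sup>2\<close>, so adding \<open>smult N E\<close>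
    carries \<open>\<chi>\<close> to \<open>T + D\<close> with \<open>D\<close> divisible by
    \<open>p\<^sup>2\<close>.\<close>
  define E where "E = smult u (T - \<chi>)"
  define D where "D = smult (v * p\<^sup>2) (\<chi> - T)"
  define \<chi>' where "\<chi>' = \<chi> + smult N E"
  have uN: "N * u = 1 - v * p\<^sup>2" using uv by (simp add: algebra_simps)
  have \<chi>'_eq: "\<chi>' = T + D"
    unfolding \<chi>'_def E_def D_def smult_smult uN by (simp add: algebra_simps smult_diff_left smult_diff_right)
  have coeff_T: "coeff T i = (if i = n then 1 else 0) + (if i = 0 then p else 0)" for i
    by (cases i) (auto simp: T_def)
  have n: "n > 0" "coeff \<chi> n = 1" using \<chi> by (auto simp: n_def)
  \<comment> \<open>Both \<open>\<chi>\<close> and \<open>T\<close> are monic of degree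
    \<open>n\<close>, so the correction leaves the leading term alone; \<open>n > 0\<close> keeps
    \<open>p\<close> away from it.\<close>
  have high: "coeff (\<chi> - T) i = 0" if "i \<ge> n" for i
    using that n by (cases "i = n") (auto simp: coeff_T coeff_eq_0 n_def)
  have c_high: "coeff \<chi>' i = (if i = n then 1 else 0)" if "i \<ge> n" for i
    using high[OF that] n that by (simp add: \<chi>'_eq D_def coeff_T)
  have deg: "degree \<chi>' = n"
  proof (rule antisym)
    show "degree \<chi>' \<le> n" using c_high by (intro degree_le) auto
    show "n \<le> degree \<chi>'" using c_high[of n] by (intro le_degree) auto
  qed
  have lead: "lead_coeff \<chi>' = 1" using c_high[of n] by (simp add: deg)
  have "Factorial_Ring.irreducible (of_int_poly \<chi>' :: rat poly)"
  proof (rule eisenstein[OF p(1) lead])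
    show "degree \<chi>' > 0" using deg n by simp
    show "p dvd coeff \<chi>' i" if "i < degree \<chi>'" for i
      using that unfolding deg by (simp add: \<chi>'_eq D_def coeff_T power2_eq_square)
    have "p\<^sup>2 dvd coeff D 0" by (simp add: D_def)
    moreover have "\<not> p\<^sup>2 dvd p"
      using p N by (auto simp: power2_eq_square dest: zdvd_imp_le)
    moreover have "coeff \<chi>' 0 = p + coeff D 0" using n by (simp add: \<chi>'_eq coeff_T)
    ultimately show "\<not> p\<^sup>2 dvd coeff \<chi>' 0" by (simp add: dvd_add_left_iff)
  qed
  thus ?thesis using that[of \<chi>' E] lead deg by (simp add: \<chi>'_def n_def)
qed

text \<open>Let \<open>N\<close> clear the denominators of \<open>h\<close>, with multiple
  \<open>H\<close>, and let an irreducible \<open>\<chi>'\<close> be congruent to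
  \<open>\<chi>\<close> modulo \<open>N\<close>. The remainder of \<open>H\<close> modulo
  \<open>\<chi>'\<close> is a multiple of \<open>N\<close>, so \<open>H\<close> is a multiple of
  \<open>\<chi>\<close> plus \<open>N\<close> times an integer polynomial, and \<open>N\<close>
  cancels.\<close>

lemma mod_monic_integral_if_irreducible:
  fixes h :: "rat poly" and \<chi> :: "int poly"
  assumes irr: "\<And>\<chi>' :: int poly. degree \<chi>' = degree \<chi> \<Longrightarrow> lead_coeff \<chi>' = 1 \<Longrightarrow>
      Factorial_Ring.irreducible (of_int_poly \<chi>' :: rat poly) \<Longrightarrow> h mod of_int_poly \<chi>' \<in> range of_int_poly"
    and \<chi>: "lead_coeff \<chi> = 1" "degree \<chi> > 0"
  shows "h mod of_int_poly \<chi> \<in> range of_int_poly"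
proof -
  obtain N and H :: "int poly" where N: "N > 0" "smult (of_int N) h = of_int_poly H"
    by (rule rat_poly_common_denom)
  obtain \<chi>' E where \<chi>': "\<chi>' = \<chi> + smult N E" "lead_coeff \<chi>' = 1" "degree \<chi>' = degree \<chi>"
    "Factorial_Ring.irreducible (of_int_poly \<chi>' :: rat poly)"
    by (rule irreducible_approximation[OF \<chi> N(1)])
  obtain R where R: "h mod of_int_poly \<chi>' = of_int_poly R"
    using irr[OF \<chi>'(3,2,4)] by blast
  obtain q r where qr: "H = \<chi>' * q + r" "degree r < degree \<chi>'"
    using int_poly_division_monic[of \<chi>' H] \<chi>' \<chi> by metis
  have "of_int_poly r = (of_int_poly H :: rat poly) mod of_int_poly \<chi>'"
    using of_int_poly_mod_monic[OF qr(2,1)] by simp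
  also have "\<dots> = smult (of_int N) (of_int_poly R)"
    unfolding N(2)[symmetric] mod_smult_left R ..
  also have "\<dots> = of_int_poly (smult N R)" by (simp only: of_int_hom.map_poly_hom_smult)
  finally have "r = smult N R" by simp
  hence H: "H = \<chi> * q + smult N (E * q + R)"
    by (simp add: qr(1) \<chi>'(1) algebra_simps smult_add_right)
  define G where "G = E * q + R"
  have "smult (of_int N) h = of_int_poly \<chi> * of_int_poly q + smult (of_int N) (of_int_poly G)"
    unfolding N(2) H G_def[symmetric]
    by (simp only: of_int_poly_hom.hom_add of_int_poly_hom.hom_mult of_int_hom.map_poly_hom_smult)
  hence "smult (of_int N) h mod of_int_poly \<chi> = smult (of_int N) (of_int_poly G) mod of_int_poly \<chi>"
    by simp
  hence "smult (of_int N) (h mod of_int_poly \<chi>) = smult (of_int N) (of_int_poly G mod of_int_poly \<chi>)"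
    by (simp only: mod_smult_left)
  hence "h mod of_int_poly \<chi> = of_int_poly G mod of_int_poly \<chi>"
    using N(1) by (metis of_int_eq_0_iff order_less_irrefl smult_cancel)
  thus ?thesis using of_int_poly_mod_monic_in_range[OF \<chi>] by simp
qed

section \<open>The integral equation\<close>

text \<open>In Horner's scheme each multiplication by \<open>f\<close> costs one factor
  \<open>d\<close>, and there are at most \<open>k\<close> of them.\<close>

lemma pcompose_clear_denom:
  fixes f :: "rat poly" and r :: "int poly"
  assumes "smult (of_int d) f = of_int_poly G" "degree r \<le> k"
  shows "smult (of_int (d ^ k)) (pcompose (of_int_poly r) f) \<in> range of_int_poly"
  using assms(2)
proof (induction r arbitrary: k)
  case 0
  show ?case by (auto intro: range_eqI[of _ _ 0])
next
  case (pCons a r)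
  show ?case
  proof (cases "r = 0")
    case True
    have "smult (of_int (d ^ k)) (pcompose (of_int_poly (pCons a r)) f) = of_int_poly [:d ^ k * a:]"
      using True by (simp add: of_int_hom.map_poly_pCons_hom pcompose_pCons)
    thus ?thesis by blast
  next
    case False
    then obtain l where l: "k = Suc l" "degree r \<le> l"
      using pCons.prems by (cases k) auto
    then obtain Q where Q: "smult (of_int (d ^ l)) (pcompose (of_int_poly r) f) = of_int_poly Q"
      using pCons.IH by blast
    have "smult (of_int (d ^ k)) (pcompose (of_int_poly (pCons a r)) f) =
        of_int_poly [:d ^ k * a:] + smult (of_int d) f * smult (of_int (d ^ l)) (pcompose (of_int_poly r) f)"
      by (simp add: of_int_hom.map_poly_pCons_hom pcompose_pCons l smult_add_right mult.commute)
    also have "\<dots> = of_int_poly ([:d ^ k * a:] + G * Q)"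
      by (simp only: assms(1) Q of_int_poly_hom.hom_add of_int_poly_hom.hom_mult)
    finally show ?thesis by blast
  qed
qed

lemma finite_bounded_polys:
  assumes "finite C"
  shows "finite {p. degree p \<le> n \<and> (\<forall>i. coeff p i \<in> C)}"
proof (rule finite_subset)
  show "{p. degree p \<le> n \<and> (\<forall>i. coeff p i \<in> C)} \<subseteq> Poly ` {xs. set xs \<subseteq> C \<and> length xs \<le> Suc n}"
  proof safe
    fix p assume p: "degree p \<le> n" "\<forall>i. coeff p i \<in> C"
    have "set (coeffs p) \<subseteq> C" using p(2) by (auto simp: coeffs_def)
    moreover have "length (coeffs p) \<le> Suc n" using p(1) by (simp add: coeffs_def)
    ultimately show "p \<in> Poly ` {xs. set xs \<subseteq> C \<and> length xs \<le> Suc n}"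
      by (intro image_eqI[of _ _ "coeffs p"]) auto
  qed
qed (intro finite_imageI finite_lists_length_le assms)

text \<open>There are finitely many monic polynomials of degree at most \<open>n\<close> modulo
  \<open>D\<close>; the product of their representatives with coefficients in \<open>{0..<D}\<close>
  is a multiple of each.\<close>

lemma monic_common_multiple_mod:
  assumes D: "D > (1 :: int)"
  obtains \<phi> :: "int poly" where "lead_coeff \<phi> = 1" "degree \<phi> > 0"
    "\<And>m. lead_coeff m = 1 \<Longrightarrow> degree m \<le> n \<Longrightarrow> \<exists>q u. \<phi> = m * q + smult D u"
proof -
  define S where "S = {c :: int poly. lead_coeff c = 1 \<and> degree c \<le> n \<and> (\<forall>i. coeff c i \<in> {0..<D})}"
  have fin: "finite S"
    by (rule finite_subset[OF _ finite_bounded_polys[of "{0..<D}" n]]) (auto simp: S_def)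
  \<comment> \<open>The factor X guarantees positive degree.\<close>
  define \<phi> where "\<phi> = [:0, 1:] * \<Prod>S"
  have "lead_coeff (\<Prod>S) = 1"
    using fin by (simp add: lead_coeff_prod S_def)
  moreover from this have "\<Prod>S \<noteq> 0" by auto
  ultimately have \<phi>: "lead_coeff \<phi> = 1" "degree \<phi> = Suc (degree (\<Prod>S))"
    by (simp_all add: \<phi>_def)
  have "\<exists>q u. \<phi> = m * q + smult D u" if m: "lead_coeff m = 1" "degree m \<le> n" for m
  proof -
    define c e where "c = map_poly (\<lambda>z. z mod D) m" and "e = map_poly (\<lambda>z. z div D) m"
    have m_eq: "m = c + smult D e"
      by (intro poly_eqI) (simp add: c_def e_def coeff_map_poly)
    \<comment> \<open>Since \<open>D > 1\<close>, the leading coefficient 1 survives reduction, so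
      \<open>c\<close> is still monic of the same degree.\<close>
    have "lead_coeff m mod D \<noteq> 0" using D m(1) by simp
    hence "degree c = degree m"
      unfolding c_def by (intro map_poly_degree_eq) auto
    hence "c \<in> S" using m D by (simp add: S_def c_def coeff_map_poly)
    hence "c dvd \<phi>" unfolding \<phi>_def using fin by (intro dvd_mult dvd_prodI)
    then obtain q where "\<phi> = c * q" by (elim dvdE)
    hence "\<phi> = m * q + smult D (- (e * q))"
      by (simp add: m_eq algebra_simps)
    thus ?thesis by blast
  qed
  thus ?thesis using that[of \<phi>] \<phi> by simp
qed

text \<open>The point is that one \<open>\<phi>\<close>, built from \<open>n\<close> and a
  denominator of \<open>f\<close> alone, serves all \<open>\<chi>\<close>: modulo \<open>D\<close>
  it is a multiple of whatever minimal polynomial f(x) has.\<close>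

lemma integral_composition:
  fixes f :: "rat poly"
  assumes f: "f \<in> Int_Q (alg_ints_eq n) (alg_ints_le n)" and n: "n > 0"
  obtains \<phi> :: "int poly" where "lead_coeff \<phi> = 1" "degree \<phi> > 0"
    "\<And>\<chi> :: int poly. degree \<chi> = n \<Longrightarrow> lead_coeff \<chi> = 1 \<Longrightarrow>
       pcompose (of_int_poly \<phi>) f mod of_int_poly \<chi> \<in> range of_int_poly"
proof -
  obtain d0 and G0 :: "int poly" where d0: "d0 > 0" "smult (of_int d0) f = of_int_poly G0"
    by (rule rat_poly_common_denom)
  \<comment> \<open>The factor 2 only ensures \<open>d\<^sup>n > 1\<close>, so that reducing modulo \<open>d\<^sup>n\<close> keeps monic polynomials monic.\<close>
  define d where "d = 2 * d0"
  have "smult (of_int d) f = smult 2 (smult (of_int d0) f)" by (simp add: d_def)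
  also have "\<dots> = of_int_poly (smult 2 G0)" by (simp add: d0(2) of_int_hom.map_poly_hom_smult)
  finally have dG: "smult (of_int d) f = of_int_poly (smult 2 G0)" .
  define D where "D = d ^ n"
  have "D > 1" unfolding D_def using n d0(1) by (intro one_less_power) (auto simp: d_def)
  then obtain \<phi> where \<phi>: "lead_coeff \<phi> = 1" "degree \<phi> > 0"
    and \<phi>_mod: "\<And>m. lead_coeff m = 1 \<Longrightarrow> degree m \<le> n \<Longrightarrow> \<exists>q u. \<phi> = m * q + smult D u"
    using monic_common_multiple_mod[of D n] by metis
  have "pcompose (of_int_poly \<phi>) f mod of_int_poly \<chi> \<in> range of_int_poly"
    if \<chi>: "degree \<chi> = n" "lead_coeff \<chi> = 1" and irr: "Factorial_Ring.irreducible (of_int_poly \<chi> :: rat poly)" for \<chi>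
  proof -
    \<comment> \<open>A root of the irreducible \<open>\<chi>\<close> has it as minimal polynomial
      and so lies in A_n, where the hypothesis on \<open>f\<close> applies.\<close>
    have "degree (map_poly to_ac (of_int_poly \<chi> :: rat poly)) > 0"
      using \<chi> n by (subst map_poly_degree_eq) auto
    then obtain x where "poly (map_poly to_ac (of_int_poly \<chi> :: rat poly)) x = 0"
      using alg_closed_imp_poly_has_root by blast
    hence x: "eval_ac (of_int_poly \<chi>) x = 0" by (simp add: eval_ac_def)
    have min_x: "min_rat_poly x = of_int_poly \<chi>"
      using irr \<chi> x by (intro min_rat_poly_eqI) auto
    hence "alg_degree x = n" using \<chi> by (simp add: alg_degree_def)
    moreover have "algebraic_int x"
      using x \<chi> by (auto simp: algebraic_int_altdef_ipoly eval_ac_of_int_poly)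
    ultimately have fx: "algebraic_int (eval_ac f x)" "alg_degree (eval_ac f x) \<le> n"
      using f by (auto simp: Int_Q_def alg_ints_eq_def alg_ints_le_def)
    obtain m where m: "min_rat_poly (eval_ac f x) = of_int_poly m" "lead_coeff m = 1"
        "degree m = alg_degree (eval_ac f x)"
      by (rule min_rat_poly_algebraic_int[OF fx(1)])
    have m0: "eval_ac (of_int_poly m) (eval_ac f x) = 0"
      using eval_ac_min_rat_poly[of "eval_ac f x"] by (simp add: m)
    have "degree m > 0"
      using degree_min_rat_poly_pos[of "eval_ac f x"] by (simp add: m)
    obtain q u where qu: "\<phi> = m * q + smult D u"
      using \<phi>_mod m fx(2) by metis
    \<comment> \<open>Only the remainder \<open>r\<close> of \<open>u\<close> matters at f(x), where
      \<open>m\<close> vanishes. Its degree is below \<open>n\<close>, so \<open>D = d ^ n\<close>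
      clears the denominators of r(f).\<close>
    obtain s r where sr: "u = m * s + r" "degree r < degree m"
      by (rule int_poly_division_monic[OF m(2) \<open>degree m > 0\<close>])
    define W where "W = smult (of_int D) (pcompose (of_int_poly r) f)"
    have "W \<in> range of_int_poly"
      unfolding W_def D_def using sr(2) m(3) fx(2) by (intro pcompose_clear_denom[OF dG]) simp
    have "\<phi> = m * (q + smult D s) + smult D r"
      by (simp add: qu sr(1) algebra_simps smult_add_right)
    hence "of_int_poly \<phi> = of_int_poly m * of_int_poly (q + smult D s) + smult (of_int D) (of_int_poly r :: rat poly)"
      by (simp add: of_int_poly_hom.hom_add of_int_poly_hom.hom_mult of_int_hom.map_poly_hom_smult)
    hence "eval_ac (pcompose (of_int_poly \<phi>) f) x = eval_ac W x"
      by (simp add: W_def eval_ac_smult eval_ac_pcompose eval_ac_add eval_ac_mult m0)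
    \<comment> \<open>Agreement at \<open>x\<close> is congruence modulo its minimal polynomial
      \<open>\<chi>\<close>.\<close>
    hence "eval_ac (pcompose (of_int_poly \<phi>) f - W) x = 0" by (simp add: eval_ac_diff)
    hence "of_int_poly \<chi> dvd pcompose (of_int_poly \<phi>) f - W"
      using min_rat_poly_dvd min_x by metis
    hence "pcompose (of_int_poly \<phi>) f mod of_int_poly \<chi> = W mod of_int_poly \<chi>"
      by (simp add: mod_eq_dvd_iff)
    moreover obtain V where "W = of_int_poly V"
      using \<open>W \<in> range of_int_poly\<close> by blast
    ultimately show ?thesis
      using of_int_poly_mod_monic_in_range[of \<chi> V] \<chi> n by (simp only:)
  qed
  \<comment> \<open>Approximation by irreducible polynomials extends the claim to every monic
    \<open>\<chi>\<close> of degree \<open>n\<close>.\<close>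
  hence "pcompose (of_int_poly \<phi>) f mod of_int_poly \<chi> \<in> range of_int_poly"
    if "degree \<chi> = n" "lead_coeff \<chi> = 1" for \<chi>
    using mod_monic_integral_if_irreducible[of \<chi> "pcompose (of_int_poly \<phi>) f"] that n by (simp only:)
  thus ?thesis by (rule that[OF \<phi>])
qed

section \<open>Second inclusion: an equation with coefficients in Int(M_n(Z))\<close>

lemma poly_to_fract_of_int_poly:
  "poly (map_poly (\<lambda>z. to_fract [:of_int z:]) \<phi>) (to_fract f) = to_fract (pcompose (of_int_poly \<phi>) f)"
  for f :: "rat poly"
proof (induction \<phi>)
  case (pCons a p)
  have "map_poly (\<lambda>z. to_fract [:of_int z :: rat:]) (pCons a p) =
      pCons (to_fract [:of_int a:]) (map_poly (\<lambda>z. to_fract [:of_int z:]) p)"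
    by (intro poly_eqI) (simp add: coeff_map_poly coeff_pCons split: nat.split)
  thus ?case
    by (simp add: pCons.IH pcompose_pCons of_int_hom.map_poly_pCons_hom)
qed simp

lemma Int_Q_subset_integral_closure:
  assumes n: "n > 0"
  shows "to_fract ` Int_Q (alg_ints_eq n) (alg_ints_le n) \<subseteq> integral_closure (to_fract ` Int_mat n)"
proof safe
  fix f assume "f \<in> Int_Q (alg_ints_eq n) (alg_ints_le n)"
  then obtain \<phi> :: "int poly" where \<phi>: "lead_coeff \<phi> = 1" "degree \<phi> > 0"
    and int: "\<And>\<chi> :: int poly. degree \<chi> = n \<Longrightarrow> lead_coeff \<chi> = 1 \<Longrightarrow>
       pcompose (of_int_poly \<phi>) f mod of_int_poly \<chi> \<in> range of_int_poly"
    using integral_composition[OF _ n] by metis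
  define h where "h = pcompose (of_int_poly \<phi>) f"
  define P where "P = map_poly (\<lambda>z. to_fract [:of_int z :: rat:]) \<phi>"
  \<comment> \<open>This is \<open>\<phi>(Y) - \<phi>(f)\<close> as a polynomial in Y over Q(X);
    \<open>h\<close> enters only the constant coefficient.\<close>
  define p where "p = P - [:to_fract h:]"
  have coeff_P: "coeff P i = to_fract [:of_int (coeff \<phi> i):]" for i
    by (simp add: P_def coeff_map_poly)
  have "degree P = degree \<phi>"
    unfolding P_def using \<phi> by (intro map_poly_degree_eq) auto
  hence "degree p = degree \<phi>"
    unfolding p_def diff_conv_add_uminus using \<phi>(2) by (subst degree_add_eq_left) auto
  \<comment> \<open>The degree of \<open>\<phi>\<close> is positive, so \<open>h\<close> does not
    touch the leading coefficient.\<close>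
  hence "lead_coeff p = 1"
    using \<phi> by (cases "degree \<phi>") (auto simp: p_def coeff_P simp flip: one_pCons)
  moreover have "coeff p i \<in> to_fract ` Int_mat n" for i
  proof -
    \<comment> \<open>Coefficient \<open>i\<close> of \<open>p\<close> as an element of Q[X]; its
      remainder modulo each monic \<open>\<chi>\<close> of degree \<open>n\<close> is integral
      because those of the integer constant and of \<open>h\<close> are.\<close>
    define g where "g = [:of_int (coeff \<phi> i):] - (if i = 0 then h else 0)"
    have "g \<in> Int_mat n"
    proof (rule mod_int_poly_imp_Int_mat)
      fix \<chi> :: "int poly" assume \<chi>: "degree \<chi> = n" "lead_coeff \<chi> = 1"
      obtain c where c: "[:of_int (coeff \<phi> i):] mod (of_int_poly \<chi> :: rat poly) = of_int_poly c"
        using of_int_poly_mod_monic_in_range[of \<chi> "[:coeff \<phi> i:]"] \<chi> n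
        by (auto simp: of_int_hom.map_poly_pCons_hom)
      obtain e where e: "h mod of_int_poly \<chi> = of_int_poly e"
        using int[OF \<chi>] by (auto simp: h_def)
      have "g mod of_int_poly \<chi> = of_int_poly (c - (if i = 0 then e else 0))"
        by (simp add: g_def poly_mod_diff_left c e of_int_poly_hom.hom_minus)
      thus "g mod of_int_poly \<chi> \<in> range of_int_poly" by blast
    qed
    moreover have "coeff p i = to_fract g"
      by (simp add: p_def coeff_P g_def coeff_pCons split: nat.split)
    ultimately show ?thesis by blast
  qed
  moreover have "poly p (to_fract f) = 0"
    unfolding p_def P_def by (simp add: poly_to_fract_of_int_poly h_def)
  ultimately show "to_fract f \<in> integral_closure (to_fract ` Int_mat n)"
    unfolding integral_closure_def integral_over_def by blast
qed

theorem mainTheorem7: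
  fixes n :: nat
  assumes "n > 0"
  shows "integral_closure (to_fract ` Int_mat n :: rat poly fract set) =
         to_fract ` Int_Q (alg_ints_eq n) (alg_ints_le n)"
  using integral_closure_Int_mat_subset Int_Q_subset_integral_closure[OF assms]
  by (rule subset_antisym)

end
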